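(* Let $A_k=\{a_1,\dots,a_k\}$ with $1=a_1<a_2<\dots<a_k$ integers. Let $h_1$ be the smallest integer $h\ge 0$ such that $n(h'+1)=n(h')+a_k$ for all integers $h'\ge h$, and let $h_2$ be the smallest integer $h\ge 0$ such that for every integer $h'\ge h$, whenever $x$ is a gap at level $h'$, $x+a_k$ is a gap at level $h'+1$. Then $h_2\ge h_1$.
   Context: For an integer $h\ge 0$, an integer $x\ge 0$ has an $h$-representation if $x=\sum_{i=1}^k c_ia_i$ with nonnegative integers $c_i$ and $\sum_i c_i\le h$. The $h$-range $n(h)$ is the largest integer $n$ such that every integer $0\le x\le n$ has an $h$-representation. An integer $x$ is a gap at level $h$ if $n(h)<x<ha_k$ and $x$ has no $h$-representation. (The values $h_1,h_2$ exist and are at least $h_0-1$, where $h_0$ is the smallest positive $h$ with $n(h)\ge a_k$.)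
   Formalization: h_2 is taken as the smallest h ≥ h_0−1 (not h ≥ 0) with the gap-shift property; with h ≥ 0 the claim fails, e.g. for A={1,3}, where h_2 would be 0 while h_1=1. *)

theory Defs
  imports Main
begin

definition has_rep :: "nat \<Rightarrow> (nat \<Rightarrow> nat) \<Rightarrow> nat \<Rightarrow> nat \<Rightarrow> bool" where
  "has_rep k a h x \<longleftrightarrow>
     (\<exists>c :: nat \<Rightarrow> nat. x = (\<Sum>i=1..k. c i * a i) \<and> (\<Sum>i=1..k. c i) \<le> h)"

definition h_range :: "nat \<Rightarrow> (nat \<Rightarrow> nat) \<Rightarrow> nat \<Rightarrow> nat" where
  "h_range k a h = (GREATEST n. \<forall>x\<le>n. has_rep k a h x)"

definition is_gap :: "nat \<Rightarrow> (nat \<Rightarrow> nat) \<Rightarrow> nat \<Rightarrow> nat \<Rightarrow> bool" where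
  "is_gap k a h x \<longleftrightarrow> h_range k a h < x \<and> x < h * a k \<and> \<not> has_rep k a h x"

definition h0 :: "nat \<Rightarrow> (nat \<Rightarrow> nat) \<Rightarrow> nat" where
  "h0 k a = (LEAST h. h > 0 \<and> h_range k a h \<ge> a k)"

definition h1 :: "nat \<Rightarrow> (nat \<Rightarrow> nat) \<Rightarrow> nat" where
  "h1 k a = (LEAST h. \<forall>h'\<ge>h. h_range k a (h' + 1) = h_range k a h' + a k)"

text \<open>
  The minimum is taken over \<open>h \<ge> h0 - 1\<close>. This bound is not automatic: for \<open>{1, 3}\<close>
  the gap condition already holds from \<open>h = 0\<close> on, although \<open>h0 = 2\<close> and \<open>h1 = 1\<close>.
  For \<open>h1\<close> no bound is needed, since \<open>h_range k a (h + 1) = h_range k a h + a k\<close> forces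
  \<open>h + 1 \<ge> h0\<close>.
\<close>

definition h2 :: "nat \<Rightarrow> (nat \<Rightarrow> nat) \<Rightarrow> nat" where
  "h2 k a = (LEAST h. h \<ge> h0 k a - 1 \<and>
     (\<forall>h'\<ge>h. \<forall>x. is_gap k a h' x \<longrightarrow> is_gap k a (h' + 1) (x + a k)))"

end

theory Submission
  imports Defs
begin

text \<open>
  Removing one copy of the largest element from a representation of \<open>x + a k\<close> at level
  \<open>h + 1\<close> represents \<open>x\<close> at level \<open>h\<close>; a representation that does not use \<open>a k\<close> only reaches
  \<open>(h + 1) * (a k - 1)\<close>, and for large \<open>h\<close> this stays below \<open>h_range k a h + a k\<close>. So \<open>h2\<close>
  is a minimum over a nonempty set. For \<open>h \<ge> h2\<close> the bound \<open>h + 1 \<ge> h0\<close> gives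
  \<open>h_range k a (h + 1) \<ge> h_range k a h + a k\<close>. Equality holds because
  \<open>h_range k a h + 1\<close> is either a gap, which is shifted to a gap, or exceeds \<open>h * a k\<close>.
\<close>

lemma has_rep_0: "has_rep k a h 0"
  unfolding has_rep_def by (rule exI[of _ "\<lambda>_. 0"]) simp

lemma has_rep_mono: "has_rep k a h x \<Longrightarrow> h \<le> h' \<Longrightarrow> has_rep k a h' x"
  unfolding has_rep_def using order_trans by blast

lemma has_rep_add:
  assumes "has_rep k a h x" and "has_rep k a h' y"
  shows "has_rep k a (h + h') (x + y)"
proof -
  obtain c d where "x = (\<Sum>i=1..k. c i * a i)" "(\<Sum>i=1..k. c i) \<le> h"
    and "y = (\<Sum>i=1..k. d i * a i)" "(\<Sum>i=1..k. d i) \<le> h'"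
    using assms unfolding has_rep_def by blast
  then show ?thesis
    unfolding has_rep_def
    by (intro exI[of _ "\<lambda>i. c i + d i"]) (simp add: sum.distrib add_mult_distrib)
qed

lemma has_rep_multiple:
  assumes "i \<in> {1..k}"
  shows "has_rep k a n (n * a i)"
proof -
  have "(\<Sum>j=1..k. (if j = i then n else 0) * a j) = n * a i"
    using assms by (simp add: if_distrib[of "\<lambda>c. c * _"] cong: if_cong)
  moreover have "(\<Sum>j=1..k. if j = i then n else 0) = n"
    using assms by simp
  ultimately show ?thesis
    unfolding has_rep_def by (intro exI[of _ "\<lambda>j. if j = i then n else 0"]) simp
qed

context
  fixes k :: nat and a :: "nat \<Rightarrow> nat"
  assumes k_pos: "k \<ge> 1" and a_1: "a 1 = 1" and a_mono: "strict_mono_on {1..k} a"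
begin

lemma le_a_k: "i \<in> {1..k} \<Longrightarrow> a i \<le> a k"
  using strict_mono_on_leD[OF a_mono, of i k] k_pos by simp

lemma a_k_pos: "a k > 0"
  using le_a_k[of 1] k_pos a_1 by simp

lemma has_rep_le:
  assumes "has_rep k a h x"
  shows "x \<le> h * a k"
proof -
  obtain c where c: "x = (\<Sum>i=1..k. c i * a i)" "(\<Sum>i=1..k. c i) \<le> h"
    using assms unfolding has_rep_def by blast
  have "x \<le> (\<Sum>i=1..k. c i * a k)"
    unfolding c(1) by (intro sum_mono mult_left_mono le_a_k) auto
  also have "\<dots> = (\<Sum>i=1..k. c i) * a k"
    by (simp add: sum_distrib_right)
  also have "\<dots> \<le> h * a k"
    using c(2) by simp
  finally show ?thesis .
qed

lemma has_rep_add_a_k: "has_rep k a h x \<Longrightarrow> has_rep k a (h + 1) (x + a k)"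
  using has_rep_add[of k a h x 1 "a k"] has_rep_multiple[of k k a 1] k_pos by simp

lemma has_rep_add_a_k_cases:
  assumes "has_rep k a (h + 1) (x + a k)"
  obtains "has_rep k a h x" | "x + a k \<le> (h + 1) * (a k - 1)"
proof -
  obtain c where c: "x + a k = (\<Sum>i=1..k. c i * a i)" "(\<Sum>i=1..k. c i) \<le> h + 1"
    using assms unfolding has_rep_def by blast
  have k_mem: "k \<in> {1..k}" using k_pos by simp
  show thesis
  proof (cases "c k = 0")
    case True
    \<comment> \<open>Strict monotonicity over the integers puts every other element at
      \<open>a k - 1\<close> or below; the term at \<open>k\<close> vanishes.\<close>
    have "c i * a i \<le> c i * (a k - 1)" if "i \<in> {1..k}" for i
    proof (cases "i = k")
      case False
      then have "a i < a k"
        using strict_mono_onD[OF a_mono that k_mem] that by simp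
      then show ?thesis by (intro mult_left_mono) auto
    qed (simp add: True)
    then have "x + a k \<le> (\<Sum>i=1..k. c i * (a k - 1))"
      unfolding c(1) by (rule sum_mono)
    also have "\<dots> = (\<Sum>i=1..k. c i) * (a k - 1)"
      by (simp add: sum_distrib_right)
    also have "\<dots> \<le> (h + 1) * (a k - 1)"
      using c(2) by (rule mult_le_mono1)
    finally show thesis by (rule that(2))
  next
    case False
    \<comment> \<open>Since \<open>c k\<close> is nonzero, the truncated subtraction is exact and
      one summand \<open>a k\<close> really disappears.\<close>
    define d where "d = c(k := c k - 1)"
    have "(\<Sum>i=1..k. c i * a i) = c k * a k + (\<Sum>i\<in>{1..k} - {k}. c i * a i)"
      and "(\<Sum>i=1..k. c i) = c k + (\<Sum>i\<in>{1..k} - {k}. c i)"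
      and "(\<Sum>i=1..k. d i * a i) = d k * a k + (\<Sum>i\<in>{1..k} - {k}. d i * a i)"
      and "(\<Sum>i=1..k. d i) = d k + (\<Sum>i\<in>{1..k} - {k}. d i)"
      by (rule sum.remove[OF finite_atLeastAtMost k_mem])+
    moreover have "(\<Sum>i\<in>{1..k} - {k}. d i * a i) = (\<Sum>i\<in>{1..k} - {k}. c i * a i)"
      and "(\<Sum>i\<in>{1..k} - {k}. d i) = (\<Sum>i\<in>{1..k} - {k}. c i)"
      by (auto simp: d_def intro!: sum.cong)
    moreover have "c k * a k = d k * a k + a k" and "c k = d k + 1"
      using False by (auto simp: d_def gr0_conv_Suc)
    ultimately have "x = (\<Sum>i=1..k. d i * a i)" and "(\<Sum>i=1..k. d i) \<le> h"
      using c by linarith+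
    then show thesis
      by (intro that(1)) (auto simp: has_rep_def)
  qed
qed

text \<open>The \<open>GREATEST\<close> is attained: 0 qualifies and \<open>h * a k\<close> bounds
  all candidates. The condition is closed downwards, which gives the equivalence.\<close>

lemma le_h_range_iff: "n \<le> h_range k a h \<longleftrightarrow> (\<forall>x\<le>n. has_rep k a h x)"
proof -
  have bound: "m \<le> h * a k" if "\<forall>x\<le>m. has_rep k a h x" for m
    using that has_rep_le by blast
  have "\<forall>x\<le>(0::nat). has_rep k a h x"
    by (simp add: has_rep_0)
  then have "\<forall>x\<le>h_range k a h. has_rep k a h x"
    unfolding h_range_def by (rule GreatestI_nat) (rule bound)
  moreover have "n \<le> h_range k a h" if "\<forall>x\<le>n. has_rep k a h x"
    unfolding h_range_def using that by (rule Greatest_le_nat) (rule bound)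
  ultimately show ?thesis
    using order_trans by blast
qed

lemma h_range_mono: "h \<le> h' \<Longrightarrow> h_range k a h \<le> h_range k a h'"
  using le_h_range_iff has_rep_mono by blast

lemma not_has_rep_Suc_h_range: "\<not> has_rep k a h (h_range k a h + 1)"
  using le_h_range_iff[of "h_range k a h" h] le_h_range_iff[of "h_range k a h + 1" h]
  by (auto simp: le_Suc_eq)

text \<open>Division with remainder by \<open>a k\<close>: at most \<open>m\<close> copies of
  \<open>a k\<close> and at most \<open>a k - 1\<close> copies of \<open>a 1 = 1\<close>
  suffice.\<close>

lemma h_range_lower_bound: "m * a k \<le> h_range k a (m + a k - 1)"
  unfolding le_h_range_iff
proof (intro allI impI)
  fix x assume "x \<le> m * a k"
  then have "x div a k \<le> m"
    using div_le_mono[of x "m * a k" "a k"] a_k_pos by simp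
  moreover have "x mod a k < a k"
    using a_k_pos by simp
  moreover have "has_rep k a (x div a k + x mod a k) (x div a k * a k + x mod a k * a 1)"
    using k_pos by (intro has_rep_add has_rep_multiple) auto
  ultimately show "has_rep k a (m + a k - 1) x"
    using a_1 by (auto elim!: has_rep_mono)
qed

lemma h0_spec: "h_range k a (h0 k a) \<ge> a k"
proof -
  have "a k > 0 \<and> h_range k a (a k) \<ge> a k"
    using h_range_lower_bound[of 1] a_k_pos by simp
  then show ?thesis
    unfolding h0_def by (rule LeastI2) simp
qed

lemma gap_shift:
  assumes "h \<ge> a k * a k" and "is_gap k a h x"
  shows "is_gap k a (h + 1) (x + a k)"
proof -
  have gap: "h_range k a h < x" "x < h * a k" "\<not> has_rep k a h x"
    using assms(2) by (auto simp: is_gap_def)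
  have "\<not> has_rep k a (h + 1) (x + a k)"
  proof
    assume "has_rep k a (h + 1) (x + a k)"
    then show False
    proof (cases rule: has_rep_add_a_k_cases)
      case 1
      then show False using gap(3) by simp
    next
      case 2
      obtain b where b: "a k = Suc b"
        using a_k_pos by (auto simp: gr0_conv_Suc)
      have "h \<ge> b"
        using assms(1) b by simp
      then obtain m where m: "h = m + b"
        using le_Suc_ex by (metis add.commute)
      have "m * a k < x"
        using h_range_lower_bound[of m] gap(1) b m by simp
      then show False
        \<comment> \<open>With \<open>b = a k - 1\<close>, the two bounds on \<open>x\<close> would
          force \<open>h + 1 < b * a k\<close>, contrary to
          \<open>h \<ge> a k * a k\<close>.\<close>
        using 2 assms(1) b m by (simp add: algebra_simps)
    qed
  qed
  moreover from this have "h_range k a (h + 1) < x + a k"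
    using le_h_range_iff[of "h_range k a (h + 1)" "h + 1"] by (meson leI order_refl)
  ultimately show ?thesis
    using gap(2) by (simp add: is_gap_def)
qed

lemma h2_spec:
  "h2 k a \<ge> h0 k a - 1 \<and>
    (\<forall>h\<ge>h2 k a. \<forall>x. is_gap k a h x \<longrightarrow> is_gap k a (h + 1) (x + a k))"
  unfolding h2_def
proof (rule LeastI, intro conjI allI impI)
  \<comment> \<open>The witness joins the bound required in \<open>h2\<close> with the threshold of
    \<open>gap_shift\<close>.\<close>
  show "h0 k a - 1 \<le> max (h0 k a) (a k * a k)"
    by simp
next
  fix h x assume "max (h0 k a) (a k * a k) \<le> h" and "is_gap k a h x"
  then show "is_gap k a (h + 1) (x + a k)"
    by (intro gap_shift) simp_all
qed

text \<open>Numbers above \<open>a k\<close> are shifts by \<open>a k\<close> of numbers in the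
  range at level \<open>h\<close>. Those up to \<open>a k\<close> need not be, and the assumption on
  \<open>h0\<close> covers them.\<close>

lemma h_range_Suc_ge:
  assumes "h + 1 \<ge> h0 k a"
  shows "h_range k a (h + 1) \<ge> h_range k a h + a k"
  unfolding le_h_range_iff
proof (intro allI impI)
  fix y assume y: "y \<le> h_range k a h + a k"
  show "has_rep k a (h + 1) y"
  proof (cases "y \<le> a k")
    case True
    then have "y \<le> h_range k a (h + 1)"
      using h0_spec h_range_mono[OF assms] by linarith
    then show ?thesis
      using le_h_range_iff by blast
  next
    case False
    then have "has_rep k a h (y - a k)"
      using y le_h_range_iff[of "y - a k" h] by auto
    then show ?thesis
      using has_rep_add_a_k[of h "y - a k"] False by simp
  qed
qed

lemma h_range_Suc_le:
  assumes "\<And>x. is_gap k a h x \<Longrightarrow> is_gap k a (h + 1) (x + a k)"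
  shows "h_range k a (h + 1) \<le> h_range k a h + a k"
proof -
  let ?x = "h_range k a h + 1"
  \<comment> \<open>Gaps lie strictly below \<open>h * a k\<close>, so this borderline value has to
    be excluded: it is represented by \<open>h\<close> copies of \<open>a k\<close>.\<close>
  have "?x \<noteq> h * a k"
    using has_rep_multiple[of k k a h] not_has_rep_Suc_h_range[of h] k_pos by auto
  then consider "?x < h * a k" | "?x > h * a k"
    by linarith
  then have "\<not> has_rep k a (h + 1) (?x + a k)"
  proof cases
    case 1
    then have "is_gap k a h ?x"
      using not_has_rep_Suc_h_range by (simp add: is_gap_def)
    then show ?thesis
      using assms[of ?x] by (simp add: is_gap_def)
  next
    case 2
    then show ?thesis
      using has_rep_le[of "h + 1" "?x + a k"] by auto
  qed
  then have "\<not> ?x + a k \<le> h_range k a (h + 1)"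
    using le_h_range_iff by blast
  then show ?thesis by simp
qed

end

theorem theorem4:
  fixes k :: nat and a :: "nat \<Rightarrow> nat"
  assumes "k \<ge> 1"
    and "a 1 = 1"
    and "strict_mono_on {1..k} a"
  shows "h2 k a \<ge> h1 k a"
proof -
  have "h_range k a (h + 1) = h_range k a h + a k" if h: "h \<ge> h2 k a" for h
  proof (rule antisym)
    show "h_range k a (h + 1) \<le> h_range k a h + a k"
      using h2_spec[OF assms] h by (intro h_range_Suc_le[OF assms]) simp
    \<comment> \<open>This is where the lower bound \<open>h0 k a - 1\<close> built into
      \<open>h2\<close> enters.\<close>
    have "h + 1 \<ge> h0 k a"
      using h2_spec[OF assms] h by linarith
    then show "h_range k a (h + 1) \<ge> h_range k a h + a k"
      by (rule h_range_Suc_ge[OF assms])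
  qed
  \<comment> \<open>Thus \<open>h2 k a\<close> satisfies the condition that \<open>h1 k a\<close>
    minimizes.\<close>
  then show ?thesis
    unfolding h1_def by (intro Least_le) blast
qed

end
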